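(* Let $k\ge 1$ be an integer. Every cyclic snake $kC_6$ is graceful if $k$ is even and near graceful if $k$ is odd.
   Context: For a graph $G=(V,E)$ with $m$ edges, a map $f:V\to\{0,1,\dots,m\}$ is a graceful labelling if $f$ is injective and the induced edge labelling $g(uv)=|f(u)-f(v)|$ is a bijection from $E$ onto $\{1,2,\dots,m\}$; $G$ is graceful if it has a graceful labelling. A map $f:V\to\{0,1,\dots,m+1\}$ is a near graceful labelling if $f$ is injective and the induced edge labelling $g(uv)=|f(u)-f(v)|$ is a bijection from $E$ onto $A$, where $A$ is $\{1,2,\dots,m-1,m\}$ or $\{1,2,\dots,m-1,m+1\}$; $G$ is near graceful if it has a near graceful labelling. Convention: all near graceful labellings asserted to exist omit both the vertex label $m$ and the edge label $m$, i.e. $f$ takes values in $\{0,1,\dots,m-1,m+1\}$ and $A=\{1,2,\dots,m-1,m+1\}$. $kC_r$ denotes any connected graph with exactly $k$ blocks, each block a cycle $C_r$ of length $r$, whose block-cutpoint graph is a path (so the blocks can be listed $B_1,\dots,B_k$ with $B_i$ and $B_{i+1}$ sharing exactly one vertex, which is the $i$-th cut vertex, and the $k-1$ cut vertices are distinct). *)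

theory Defs
  imports Main
begin

record 'a ugraph =
  verts :: "'a set"
  edges :: "'a set set"

definition simple_graph :: "'a ugraph \<Rightarrow> bool" where
  "simple_graph G \<longleftrightarrow> finite (verts G) \<and> (\<forall>e\<in>edges G. e \<subseteq> verts G \<and> card e = 2)"

definition subgraph :: "'a ugraph \<Rightarrow> 'a ugraph \<Rightarrow> bool" where
  "subgraph H G \<longleftrightarrow> simple_graph H \<and> verts H \<subseteq> verts G \<and> edges H \<subseteq> edges G"

definition reachable :: "'a ugraph \<Rightarrow> 'a \<Rightarrow> 'a \<Rightarrow> bool" where
  "reachable G = (\<lambda>u v. {u, v} \<in> edges G)\<^sup>*\<^sup>*"

definition connected_graph :: "'a ugraph \<Rightarrow> bool" where
  "connected_graph G \<longleftrightarrow> verts G \<noteq> {} \<and> (\<forall>u\<in>verts G. \<forall>v\<in>verts G. reachable G u v)"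

definition delete_vertex :: "'a ugraph \<Rightarrow> 'a \<Rightarrow> 'a ugraph" where
  "delete_vertex G v = \<lparr>verts = verts G - {v}, edges = {e \<in> edges G. v \<notin> e}\<rparr>"

definition cut_vertex :: "'a ugraph \<Rightarrow> 'a \<Rightarrow> bool" where
  "cut_vertex G v \<longleftrightarrow> v \<in> verts G \<and>
     (\<exists>u \<in> verts G - {v}. \<exists>w \<in> verts G - {v}. reachable G u w \<and> \<not> reachable (delete_vertex G v) u w)"

definition nonseparable :: "'a ugraph \<Rightarrow> bool" where
  "nonseparable G \<longleftrightarrow> connected_graph G \<and> (\<nexists>v. cut_vertex G v)"

definition blocks :: "'a ugraph \<Rightarrow> 'a ugraph set" where
  "blocks G = {B. subgraph B G \<and> nonseparable B \<and>
                  (\<forall>B'. subgraph B' G \<and> nonseparable B' \<and> subgraph B B' \<longrightarrow> B' = B)}"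

definition block_cutpoint_graph :: "'a ugraph \<Rightarrow> ('a ugraph + 'a) ugraph" where
  "block_cutpoint_graph G =
     \<lparr>verts = Inl ` blocks G \<union> Inr ` {v. cut_vertex G v},
      edges = {{Inl B, Inr v} | B v. B \<in> blocks G \<and> cut_vertex G v \<and> v \<in> verts B}\<rparr>"

text \<open>A single vertex counts as a path.\<close>

definition path_graph :: "'a ugraph \<Rightarrow> bool" where
  "path_graph G \<longleftrightarrow> (\<exists>xs. xs \<noteq> [] \<and> distinct xs \<and> verts G = set xs \<and>
     edges G = {{xs ! i, xs ! Suc i} | i. Suc i < length xs})"

definition cycle_graph :: "nat \<Rightarrow> 'a ugraph \<Rightarrow> bool" where
  "cycle_graph r G \<longleftrightarrow> r \<ge> 3 \<and> (\<exists>xs. length xs = r \<and> distinct xs \<and> verts G = set xs \<and>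
     edges G = {{xs ! i, xs ! (Suc i mod r)} | i. i < r})"

definition cyclic_snake :: "nat \<Rightarrow> nat \<Rightarrow> 'a ugraph \<Rightarrow> bool" where
  "cyclic_snake k r G \<longleftrightarrow> simple_graph G \<and> connected_graph G \<and> card (blocks G) = k \<and>
     (\<forall>B\<in>blocks G. cycle_graph r B) \<and> path_graph (block_cutpoint_graph G)"

definition edge_label :: "('a \<Rightarrow> nat) \<Rightarrow> 'a set \<Rightarrow> nat" where
  "edge_label f e = (THE d. \<exists>u v. e = {u, v} \<and> d = nat \<bar>int (f u) - int (f v)\<bar>)"

lemma edge_label_doubleton: "edge_label f {u, v} = nat \<bar>int (f u) - int (f v)\<bar>"
  unfolding edge_label_def by (rule the_equality) (auto simp: doubleton_eq_iff)

definition graceful_labelling :: "'a ugraph \<Rightarrow> ('a \<Rightarrow> nat) \<Rightarrow> bool" where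
  "graceful_labelling G f \<longleftrightarrow>
     f ` verts G \<subseteq> {0..card (edges G)} \<and> inj_on f (verts G) \<and>
     bij_betw (edge_label f) (edges G) {1..card (edges G)}"

definition graceful :: "'a ugraph \<Rightarrow> bool" where
  "graceful G \<longleftrightarrow> (\<exists>f. graceful_labelling G f)"

definition near_graceful_labelling :: "'a ugraph \<Rightarrow> ('a \<Rightarrow> nat) \<Rightarrow> bool" where
  "near_graceful_labelling G f \<longleftrightarrow>
     f ` verts G \<subseteq> {0..card (edges G) + 1} \<and> inj_on f (verts G) \<and>
     (bij_betw (edge_label f) (edges G) {1..card (edges G)} \<or>
      bij_betw (edge_label f) (edges G) ({1..<card (edges G)} \<union> {card (edges G) + 1}))"

end

theory Submission
  imports Defs
begin

text \<open>
  The labelling is built from one end of the snake, two hexagons at a time. Call a labelling of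
  a bipartite piece split at \<open>l\<close> if every edge joins a label at most \<open>l\<close> to a
  label above \<open>l\<close> (graceful labellings of this kind are Rosa's \<open>\<alpha>\<close>-labellings).
  Raising all labels above \<open>l\<close> by \<open>m\<close>
  raises every edge label of the piece by exactly \<open>m\<close> and opens a gap in the range of vertex
  labels, into which a gracefully labelled graph with \<open>m\<close> edges fits: its edges supply the edge
  labels \<open>1, \<dots>, m\<close> that the piece has given up. The two graphs can share a vertex
  \<open>v\<close>, provided that \<open>v\<close> borders the gap, with label \<open>l\<close> or \<open>l + 1\<close> in the piece,
  and that \<open>v\<close> has label \<open>0\<close> in the graph to be inserted; if \<open>v\<close> lies on the upper
  border, the inserted labelling is turned upside down. This is lemma \<open>glue_labellings\<close>.

  A single hexagon has no graceful labelling, since the sum of the edge labels around a cycle is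
  even and \<open>1 + \<dots> + 6\<close> is odd, so the piece is a pair of hexagons. Whatever the distances
  between the vertex where the pair is entered, the common vertex of the pair and the vertex where
  it is left, the pair has a labelling with label \<open>0\<close> at the entry and a label bordering the
  gap at the exit (lemma \<open>two_hexagons_labelling\<close>); six explicit tables cover all nine
  combinations of distances. Since label \<open>0\<close> at the entry survives the gluing, induction
  labels every chain with an even number of hexagons. An odd chain is an even one with one hexagon
  in front, labelled with edge labels \<open>1, \<dots>, 5, 7\<close>. As these are raised above all others,
  the missing edge label is the number of edges.

  It remains to find such a chain in a connected graph whose block-cutpoint graph is a path. The
  decisive fact is that a vertex in two blocks is a cut vertex (lemma \<open>shared_vertex_cut\<close>):
  otherwise a path around the vertex would join both blocks to a larger nonseparable subgraph. A
  vertex common to two blocks is therefore a neighbour of both in the path, so that only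
  consecutive blocks meet, and they meet in the single cut vertex between them.
\<close>

section \<open>Gluing labellings at a vertex\<close>

text \<open>Graceful and near graceful labellings are the instances with particular sets \<open>L\<close> of
  admissible vertex labels and \<open>S\<close> of edge labels to be attained.\<close>

definition labels_with :: "'a set \<Rightarrow> 'a set set \<Rightarrow> nat set \<Rightarrow> nat set \<Rightarrow> ('a \<Rightarrow> nat) \<Rightarrow> bool" where
  "labels_with V E L S f \<longleftrightarrow> inj_on f V \<and> f ` V \<subseteq> L \<and> bij_betw (edge_label f) E S"

lemma labels_with_mono: "labels_with V E L S f \<Longrightarrow> L \<subseteq> L' \<Longrightarrow> labels_with V E L' S f"
  unfolding labels_with_def by blast

definition edges_within :: "'a set \<Rightarrow> 'a set set \<Rightarrow> bool" where
  "edges_within V E \<longleftrightarrow> (\<forall>e\<in>E. \<exists>a\<in>V. \<exists>b\<in>V. e = {a, b})"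

text \<open>For edges with two ends this says that one end is labelled at most \<open>l\<close> and the other
  one above \<open>l\<close>, without naming which is which.\<close>

definition split_at :: "nat \<Rightarrow> 'a set set \<Rightarrow> ('a \<Rightarrow> nat) \<Rightarrow> bool" where
  "split_at l E f \<longleftrightarrow> (\<forall>e\<in>E. (\<exists>a\<in>e. f a \<le> l) \<and> (\<exists>b\<in>e. l < f b))"

text \<open>The labels of the piece above \<open>l\<close> move up by \<open>m\<close>, so each of its edge labels grows
  by \<open>m\<close>. The other labelling occupies \<open>l, \<dots>, l + m\<close> if the shared vertex lies below
  the gap, and is reflected onto \<open>l + 1, \<dots>, l + 1 + m\<close> if it lies above. In both cases the
  shared vertex gets the same label from both sides and is the only one on its border of the gap.
  Labels at most \<open>l\<close> stay, which lets the vertex labelled \<open>0\<close> serve as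
  the attachment vertex of the next gluing.\<close>

lemma glue_labellings:
  assumes g: "labels_with V E L S g" and split: "split_at l E g"
    and E: "edges_within V E"
    and f: "labels_with W F {0..m} {1..m} f" and F: "edges_within W F"
    and v: "V \<inter> W = {v}" "f v = 0" "g v = l \<or> g v = Suc l"
  shows "\<exists>h. labels_with (V \<union> W) (E \<union> F)
              ({i \<in> L. i \<le> l} \<union> {l..l + m} \<union> (+) m ` {i \<in> L. l < i}) ({1..m} \<union> (+) m ` S) h
           \<and> (\<forall>x\<in>V. g x \<le> l \<longrightarrow> h x = g x)"
proof -
  define p where "p x = (if g x \<le> l then g x else m + g x)" for x
  define q where "q x = (if g v = l then l + f x else Suc l + m - f x)" for x
  define h where "h x = (if x \<in> V then p x else q x)" for x
  have pq: "p v = q v" using v by (auto simp: p_def q_def)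
  have hV: "h x = p x" if "x \<in> V" for x using that by (simp add: h_def)
  have hW: "h x = q x" if "x \<in> W" for x
    using that pq v(1) by (cases "x \<in> V") (auto simp: h_def)
  have fW: "f x \<le> m" if "x \<in> W" for x using f that by (auto simp: labels_with_def)
  \<comment> \<open>Beyond the shared vertex the inserted labels leave the border of the gap, which keeps
    them apart from the labels of the piece.\<close>
  have f0: "0 < f x" if "x \<in> W" "x \<notin> V" for x
  proof -
    have "f x \<noteq> f v" using f that v(1) unfolding labels_with_def inj_on_def by blast
    then show ?thesis using v(2) by simp
  qed
  have vV: "v \<in> V" "v \<in> W" using v(1) by auto
  have inj: "inj_on h (V \<union> W)"
  proof -
    have "inj_on h V"
      using g by (auto simp: labels_with_def inj_on_def hV p_def split: if_splits)
    moreover have "inj_on h W"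
    proof (rule inj_onI)
      fix x y assume xy: "x \<in> W" "y \<in> W" "h x = h y"
      then have "f x = f y" using fW[of x] fW[of y] by (auto simp: hW q_def split: if_splits)
      then show "x = y" using f xy by (auto simp: labels_with_def inj_on_def)
    qed
    moreover have "h x \<noteq> h y" if "x \<in> V - W" "y \<in> W - V" for x y
    proof -
      have "g x \<noteq> g v" using g that vV unfolding labels_with_def inj_on_def by blast
      then show ?thesis
        using that f0[of y] fW[of y] v(3) by (auto simp: hV hW p_def q_def split: if_splits)
    qed
    ultimately show ?thesis
      unfolding inj_on_Un by blast
  qed
  have range: "h ` (V \<union> W) \<subseteq> {i \<in> L. i \<le> l} \<union> {l..l + m} \<union> (+) m ` {i \<in> L. l < i}" (is "_ \<subseteq> ?R")
  proof -
    have "h x \<in> ?R" if "x \<in> V" for x using that g by (auto simp: hV p_def labels_with_def)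
    moreover have "h x \<in> ?R" if "x \<in> W" "x \<notin> V" for x
      using that fW[of x] f0[of x] v(3) by (auto simp: hW q_def)
    ultimately show ?thesis by blast
  qed
  have eE: "edge_label h e = m + edge_label g e \<and> 0 < edge_label g e" if e: "e \<in> E" for e
  proof -
    obtain a b where ab: "a \<in> V" "b \<in> V" "e = {a, b}"
      using E e unfolding edges_within_def by blast
    moreover have "(g a \<le> l \<and> l < g b) \<or> (g b \<le> l \<and> l < g a)"
      using split e unfolding split_at_def ab(3) by fastforce
    ultimately show ?thesis by (auto simp: edge_label_doubleton hV p_def)
  qed
  have eF: "edge_label h e = edge_label f e" if e: "e \<in> F" for e
  proof -
    obtain a b where "a \<in> W" "b \<in> W" "e = {a, b}" using F e unfolding edges_within_def by blast
    then show ?thesis using fW[of a] fW[of b]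
      by (auto simp: edge_label_doubleton hW q_def)
  qed
  have S: "0 < s" if "s \<in> S" for s
    using g eE that unfolding labels_with_def bij_betw_def by blast
  have "bij_betw (edge_label h) E ((+) m ` S)"
  proof -
    have "bij_betw ((+) m \<circ> edge_label g) E ((+) m ` S)"
      using g unfolding labels_with_def by (intro bij_betw_trans) (auto simp: bij_betw_def)
    then show ?thesis using eE by (simp cong: bij_betw_cong)
  qed
  moreover have "bij_betw (edge_label h) F {1..m}"
    using f eF unfolding labels_with_def by (simp cong: bij_betw_cong)
  moreover have "{1..m} \<inter> (+) m ` S = {}" using S by fastforce
  ultimately have "bij_betw (edge_label h) (E \<union> F) ({1..m} \<union> (+) m ` S)"
    using bij_betw_combine by (metis Un_commute)
  then have "labels_with (V \<union> W) (E \<union> F) ?R ({1..m} \<union> (+) m ` S) h"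
    using inj range unfolding labels_with_def by blast
  moreover have "\<forall>x\<in>V. g x \<le> l \<longrightarrow> h x = g x" by (simp add: hV p_def)
  ultimately show ?thesis by blast
qed

section \<open>Chains of hexagons\<close>

definition hexagon :: "'a ugraph \<Rightarrow> 'a \<Rightarrow> 'a \<Rightarrow> 'a \<Rightarrow> 'a \<Rightarrow> 'a \<Rightarrow> 'a \<Rightarrow> bool" where
  "hexagon B a b c d e f \<longleftrightarrow> distinct [a, b, c, d, e, f] \<and> verts B = {a, b, c, d, e, f} \<and>
     edges B = {{a, b}, {b, c}, {c, d}, {d, e}, {e, f}, {f, a}}"

lemma cycle_graph_hexagon:
  assumes "cycle_graph 6 B" obtains a b c d e f where "hexagon B a b c d e f"
proof -
  obtain xs where xs: "length xs = 6" "distinct xs" "verts B = set xs"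
    "edges B = {{xs ! i, xs ! (Suc i mod 6)} | i. i < 6}"
    using assms unfolding cycle_graph_def by blast
  obtain a b c d e f where abc: "xs = [a, b, c, d, e, f]"
    using xs(1) by (auto simp: numeral_eq_Suc length_Suc_conv)
  have "edges B = (\<lambda>i. {xs ! i, xs ! (Suc i mod 6)}) ` {..<6}"
    unfolding xs(4) by auto
  also have "{..<6::nat} = {0, 1, 2, 3, 4, 5}" by auto
  finally have "edges B = {{a, b}, {b, c}, {c, d}, {d, e}, {e, f}, {f, a}}"
    by (simp add: abc)
  then have "hexagon B a b c d e f" using xs(2,3) unfolding hexagon_def abc by simp
  then show thesis by (rule that)
qed

lemma hexagon_rotate:
  assumes "hexagon B a b c d e f" shows "hexagon B b c d e f a"
proof -
  have rot: "{p, q, r, s, t, z} = {q, r, s, t, z, p}" for p q r s t z :: 'b by auto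
  show ?thesis using assms unfolding hexagon_def
    by (simp only: rot[of "{a, b}"] rot[of a]) force
qed

lemma hexagon_reverse:
  assumes "hexagon B a b c d e f" shows "hexagon B a f e d c b"
proof -
  have rev: "{p, q, r, s, t, z} = {z, t, s, r, q, p}" for p q r s t z :: 'b by auto
  have "{b, c, d, e, f} = {f, e, d, c, b}" by auto
  moreover have "{{a, b}, {b, c}, {c, d}, {d, e}, {e, f}, {f, a}}
      = {{a, f}, {f, e}, {e, d}, {d, c}, {c, b}, {b, a}}"
    by (subst rev) (simp only: insert_commute[where A = "{}"])
  moreover have "distinct [a, f, e, d, c, b]" using assms by (auto simp: hexagon_def)
  ultimately show ?thesis using assms unfolding hexagon_def by argo
qed

lemma hexagon_start:
  assumes "cycle_graph 6 B" "u \<in> verts B"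
  obtains b c d e f where "hexagon B u b c d e f"
proof -
  obtain a b c d e f where h: "hexagon B a b c d e f" using cycle_graph_hexagon assms(1) .
  note rot = hexagon_rotate
  have "u = a \<or> u = b \<or> u = c \<or> u = d \<or> u = e \<or> u = f"
    using h assms(2) by (simp add: hexagon_def)
  then show thesis
    using that h rot[OF h] rot[OF rot[OF h]] rot[OF rot[OF rot[OF h]]]
      rot[OF rot[OF rot[OF rot[OF h]]]] rot[OF rot[OF rot[OF rot[OF rot[OF h]]]]] by blast
qed

text \<open>Reading the hexagon in the better of its two directions leaves three distances to consider
  instead of five.\<close>

lemma hexagon_start_near:
  assumes "cycle_graph 6 B" "u \<in> verts B" "v \<in> verts B" "u \<noteq> v"
  obtains b c d e f where "hexagon B u b c d e f" "v = b \<or> v = c \<or> v = d"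
proof -
  obtain b c d e f where h: "hexagon B u b c d e f" using hexagon_start assms(1,2) .
  have "v = b \<or> v = c \<or> v = d \<or> v = e \<or> v = f" using h assms by (simp add: hexagon_def)
  then show thesis using that[OF h] that[OF hexagon_reverse[OF h]] by blast
qed

text \<open>The vertex argument is where the next hexagon may be attached. It must not be the vertex
  \<open>v\<close> at which the first hexagon meets the rest, so that the attachment vertices along the
  chain are distinct. The base case is a single vertex rather than a single
  hexagon, because labellings are built from it by adding hexagons in pairs.\<close>

inductive hexagon_chain :: "'a \<Rightarrow> nat \<Rightarrow> 'a set \<Rightarrow> 'a set set \<Rightarrow> bool" where
  empty: "hexagon_chain u 0 {u} {}"
| attach: "hexagon_chain v n V E \<Longrightarrow> cycle_graph 6 B \<Longrightarrow> u \<in> verts B \<Longrightarrow> u \<noteq> v \<Longrightarrow>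
    verts B \<inter> V = {v} \<Longrightarrow> hexagon_chain u (Suc n) (verts B \<union> V) (edges B \<union> E)"

lemma edges_within_Un:
  "edges_within V E \<Longrightarrow> edges_within W F \<Longrightarrow> edges_within (V \<union> W) (E \<union> F)"
  unfolding edges_within_def by (metis Un_iff)

lemma edges_within_hexagon:
  assumes "cycle_graph 6 B" shows "edges_within (verts B) (edges B)"
proof -
  obtain a b c d e f where "hexagon B a b c d e f" using cycle_graph_hexagon assms .
  then have V: "verts B = {a, b, c, d, e, f}"
    and E: "edges B = {{a, b}, {b, c}, {c, d}, {d, e}, {e, f}, {f, a}}" by (simp_all add: hexagon_def)
  have "x \<in> verts B \<Longrightarrow> y \<in> verts B \<Longrightarrow> \<exists>p\<in>verts B. \<exists>q\<in>verts B. {x, y} = {p, q}" for x y by blast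
  then show ?thesis unfolding edges_within_def E by (simp add: V)
qed

lemma edges_within_hexagon_chain: "hexagon_chain u n V E \<Longrightarrow> edges_within V E"
proof (induction rule: hexagon_chain.induct)
  case (attach v n V E B u)
  then show ?case by (intro edges_within_Un edges_within_hexagon)
qed (simp add: edges_within_def)

section \<open>Explicit labellings of one and two hexagons\<close>

text \<open>If as many edge labels arise as there are entries in the list of edges, then no two
  edges share a label; this also covers the distinctness of the listed edges.\<close>

lemma labels_with_lists:
  assumes "map g xs = ls" "distinct ls" "set ls \<subseteq> L"
    and "edge_label g ` set es = S" "card S = length es"
  shows "labels_with (set xs) (set es) L S g"
proof -
  have "inj_on g (set xs)" using assms(1,2) by (metis distinct_map)
  moreover have "g ` set xs \<subseteq> L" using assms(1,3) by (metis set_map)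
  moreover have "card (edge_label g ` set es) = card (set es)"
    using assms(4,5) card_length[of es] card_image_le[of "set es" "edge_label g"] by simp
  then have "inj_on (edge_label g) (set es)" by (simp add: eq_card_imp_inj_on)
  ultimately show ?thesis using assms(4) unfolding labels_with_def bij_betw_def by blast
qed

lemma ex_map_eq:
  assumes "distinct xs" "length xs = length L" shows "\<exists>g. map g xs = L"
proof -
  have "map (the \<circ> map_of (zip xs L)) xs = L"
    using assms by (intro nth_equalityI) (auto simp: map_of_zip_nth)
  then show ?thesis by (rule exI[of _ "the \<circ> map_of (zip xs L)"])
qed

text \<open>The exit \<open>w\<close> gets label \<open>l\<close> or \<open>l + 1\<close> according to the parity of its
  distance from \<open>u\<close>, since \<open>u\<close> lies on the low side of the bipartition. The tables
  list the labels around the first hexagon, starting at the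
  entry \<open>u\<close>, and then around the second one, continuing after the common vertex \<open>v\<close>.
  Distances \<open>2\<close> and \<open>3\<close> from \<open>v\<close> to \<open>w\<close> share a table, in which the two possible
  exits carry the labels \<open>l\<close> and \<open>l + 1\<close>.\<close>

lemma two_hexagons_labelling:
  assumes B: "cycle_graph 6 B" "u \<in> verts B" "u \<noteq> v"
    and C: "cycle_graph 6 C" "w \<in> verts C" "v \<noteq> w" and BC: "verts B \<inter> verts C = {v}"
  shows "\<exists>g l. labels_with (verts B \<union> verts C) (edges B \<union> edges C) {0..12} {1..12} g \<and>
    split_at l (edges B \<union> edges C) g \<and> g u = 0 \<and> l < 12 \<and> (g w = l \<or> g w = Suc l)"
    (is "\<exists>g l. ?P g l")
proof -
  obtain b c d e f where b: "hexagon B u b c d e f" "v = b \<or> v = c \<or> v = d"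
    using hexagon_start_near[OF B(1,2) _ B(3)] BC by blast
  obtain b' c' d' e' f' where c: "hexagon C v b' c' d' e' f'"
    "w = b' \<or> w = c' \<or> w = d'"
    using hexagon_start_near[OF C(1) _ C(2,3)] BC by blast
  let ?xs = "[u, b, c, d, e, f, b', c', d', e', f']"
  let ?es = "[{u, b}, {b, c}, {c, d}, {d, e}, {e, f}, {f, u}, {v, b'}, {b', c'}, {c', d'}, {d', e'}, {e', f'}, {f', v}]"
  have VB: "verts B = set [u, b, c, d, e, f]" and VC: "verts C = set [v, b', c', d', e', f']"
    and dB: "distinct [u, b, c, d, e, f]" and dC: "distinct [v, b', c', d', e', f']"
    using b(1) c(1) by (simp_all add: hexagon_def)
  have "set [b', c', d', e', f'] = verts C - {v}" using VC dC by auto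
  then have "set [u, b, c, d, e, f] \<inter> set [b', c', d', e', f'] = {}" using VB BC by blast
  moreover have "distinct [b', c', d', e', f']" using dC by simp
  ultimately have "distinct ([u, b, c, d, e, f] @ [b', c', d', e', f'])"
    using dB by (simp only: distinct_append)
  then have dist: "distinct ?xs" by (simp only: append.simps)
  have "v \<in> verts B" using BC by blast
  then have V: "verts B \<union> verts C = set ?xs" unfolding VB VC by auto
  have EB: "edges B = set [{u, b}, {b, c}, {c, d}, {d, e}, {e, f}, {f, u}]"
    and EC: "edges C = set [{v, b'}, {b', c'}, {c', d'}, {d', e'}, {e', f'}, {f', v}]"
    using b(1) c(1) by (simp_all add: hexagon_def)
  have E: "edges B \<union> edges C = set ?es"
    unfolding EB EC set_append[symmetric] by (simp only: append.simps)
  have table: "\<exists>g l. ?P g l"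
    if ls: "length ls = 11" "distinct ls" "set ls \<subseteq> {0..12}" "l < 12"
      and labels: "\<And>g. map g ?xs = ls \<Longrightarrow> edge_label g ` set ?es = {1..12} \<and> split_at l (set ?es) g \<and>
        g u = 0 \<and> (g w = l \<or> g w = Suc l)" for l and ls :: "nat list"
  proof -
    obtain g where g: "map g ?xs = ls" using ex_map_eq[OF dist, of ls] ls(1) by auto
    have "labels_with (set ?xs) (set ?es) {0..12} {1..12} g"
      using conjunct1[OF labels[OF g]] by (rule labels_with_lists[OF g ls(2,3)]) simp
    then show ?thesis unfolding V E using labels[OF g] ls(4) by blast
  qed
  have twelve: "{Suc 0..12} = {1, 2, 3, 4, 5, 6, 7, 8, 9, 10, 11, 12}"
    by (simp add: atLeastAtMost_upt upt_rec numeral_eq_Suc)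
  note concrete = edge_label_doubleton split_at_def twelve set_eq_subset
  consider "v = b" "w = b'" | "v = b" "w = c' \<or> w = d'" | "v = c" "w = b'" | "v = c" "w = c' \<or> w = d'"
    | "v = d" "w = b'" | "v = d" "w = c' \<or> w = d'" using b c by auto
  then show ?thesis
  proof cases
    case 1
    then show ?thesis
      by (intro table[of "[0, 9, 3, 11, 1, 12, 5, 6, 4, 7, 2]" 5]) (auto simp: concrete)
  next
    case 2
    then show ?thesis
      by (intro table[of "[0, 9, 3, 11, 1, 12, 2, 6, 5, 7, 4]" 5]) (auto simp: concrete)
  next
    case 3
    then show ?thesis
      by (intro table[of "[0, 9, 4, 11, 1, 12, 5, 3, 6, 2, 10]" 4]) (auto simp: concrete)
  next
    case 4
    then show ?thesis
      by (intro table[of "[0, 6, 2, 11, 1, 12, 7, 4, 5, 3, 10]" 4]) (auto simp: concrete)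
  next
    case 5
    then show ?thesis
      by (intro table[of "[0, 10, 4, 6, 1, 12, 5, 9, 2, 11, 3]" 5]) (auto simp: concrete)
  next
    case 6
    then show ?thesis
      by (intro table[of "[0, 11, 1, 9, 3, 12, 2, 6, 5, 7, 4]" 5]) (auto simp: concrete)
  qed
qed

text \<open>Around the hexagon the labels \<open>2, 3, 1, 4, 0, 7\<close> give the edge labels
  \<open>1, 2, 3, 4, 7, 5\<close>. Vertex label \<open>6\<close> and edge label \<open>6\<close> are omitted, as the
  convention for near graceful labellings requires.\<close>

lemma one_hexagon_labelling:
  assumes "cycle_graph 6 B" "v \<in> verts B"
  shows "\<exists>g. labels_with (verts B) (edges B) ({0..<6} \<union> {7}) ({1..<6} \<union> {7}) g \<and>
    split_at 2 (edges B) g \<and> g v = 2"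
proof -
  obtain b c d e f where b: "hexagon B v b c d e f" using hexagon_start assms .
  let ?xs = "[v, b, c, d, e, f]"
  let ?es = "[{v, b}, {b, c}, {c, d}, {d, e}, {e, f}, {f, v}]"
  have dist: "distinct ?xs" using b by (simp add: hexagon_def)
  have V: "verts B = set ?xs" and E: "edges B = set ?es" using b by (simp_all add: hexagon_def)
  have "\<exists>g :: 'a \<Rightarrow> nat. map g ?xs = [2, 3, 1, 4, 0, 7]"
    by (rule ex_map_eq[OF dist]) simp
  then obtain g :: "'a \<Rightarrow> nat" where g: "map g ?xs = [2, 3, 1, 4, 0, 7]" ..
  have six: "{1..<6} \<union> {7} = {1, 2, 3, 4, 5, 7::nat}" by auto
  have "edge_label g ` set ?es = {1..<6} \<union> {7}"
    using g unfolding six by (auto simp: edge_label_doubleton)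
  then have "labels_with (set ?xs) (set ?es) ({0..<6} \<union> {7}) ({1..<6} \<union> {7}) g"
    by (rule labels_with_lists[OF g, rotated 2]) auto
  moreover have "split_at 2 (set ?es) g"
    using g by (auto simp: split_at_def)
  moreover have "g v = 2" using g by simp
  ultimately show ?thesis unfolding V E by blast
qed

section \<open>Labelling chains\<close>

text \<open>The condition \<open>f u = 0\<close> is what the gluing needs when two further hexagons are put in
  front.\<close>

lemma even_chain_labelling:
  "hexagon_chain u (2 * n) V E \<Longrightarrow> \<exists>f. labels_with V E {0..12 * n} {1..12 * n} f \<and> f u = 0"
proof (induction n arbitrary: u V E)
  case 0
  then have "V = {u}" "E = {}" by (auto elim: hexagon_chain.cases)
  then show ?case by (intro exI[of _ "\<lambda>_. 0"]) (simp add: labels_with_def bij_betw_def)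
next
  case (Suc n)
  from Suc.prems obtain v V' E' B where B: "hexagon_chain v (Suc (2 * n)) V' E'" "cycle_graph 6 B"
    "u \<in> verts B" "u \<noteq> v" "verts B \<inter> V' = {v}" "V = verts B \<union> V'" "E = edges B \<union> E'"
    by (auto elim: hexagon_chain.cases)
  from B(1) obtain w W F C where C: "hexagon_chain w (2 * n) W F" "cycle_graph 6 C"
    "v \<in> verts C" "v \<noteq> w" "verts C \<inter> W = {w}" "V' = verts C \<union> W" "E' = edges C \<union> F"
    by (auto elim: hexagon_chain.cases)
  have BC: "verts B \<inter> verts C = {v}" and meet: "(verts B \<union> verts C) \<inter> W = {w}" and w: "w \<in> verts C"
    using B(5) C(3-6) by auto
  obtain f where f: "labels_with W F {0..12 * n} {1..12 * n} f" "f w = 0"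
    using Suc.IH C(1) by blast
  obtain g l where g: "labels_with (verts B \<union> verts C) (edges B \<union> edges C) {0..12} {1..12} g"
    "split_at l (edges B \<union> edges C) g" "g u = 0" "l < 12" "g w = l \<or> g w = Suc l"
    using two_hexagons_labelling[OF B(2,3,4) C(2) w C(4) BC] by blast
  note edges = edges_within_Un[OF edges_within_hexagon[OF B(2)] edges_within_hexagon[OF C(2)]]
  obtain h where h: "labels_with (verts B \<union> verts C \<union> W) (edges B \<union> edges C \<union> F)
      ({i \<in> {0..12}. i \<le> l} \<union> {l..l + 12 * n} \<union> (+) (12 * n) ` {i \<in> {0..12}. l < i})
      ({1..12 * n} \<union> (+) (12 * n) ` {1..12}) h"
    "\<forall>x\<in>verts B \<union> verts C. g x \<le> l \<longrightarrow> h x = g x"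
    using glue_labellings[OF g(1,2) edges f(1) edges_within_hexagon_chain[OF C(1)] meet f(2) g(5)] by blast
  have S: "{1..12 * n} \<union> (+) (12 * n) ` {1..12} = {1..12 * Suc n}" by auto
  have L: "{i \<in> {0..12}. i \<le> l} \<union> {l..l + 12 * n} \<union> (+) (12 * n) ` {i \<in> {0..12}. l < i}
      \<subseteq> {0..12 * Suc n}" using g(4) by auto
  have "labels_with V E {0..12 * Suc n} {1..12 * Suc n} h"
    using labels_with_mono[OF h(1)[unfolded S] L] unfolding B(6,7) C(6,7) Un_assoc .
  moreover have "h u = 0" using h(2) g(3) B(3) by simp
  ultimately show ?case by blast
qed

lemma odd_chain_labelling:
  assumes "hexagon_chain u (Suc (2 * n)) V E"
  shows "\<exists>f. labels_with V E ({0..<12 * n + 6} \<union> {12 * n + 7}) ({1..<12 * n + 6} \<union> {12 * n + 7}) f"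
proof -
  from assms obtain v W F B where B: "hexagon_chain v (2 * n) W F" "cycle_graph 6 B"
    "verts B \<inter> W = {v}" "V = verts B \<union> W" "E = edges B \<union> F"
    by (auto elim: hexagon_chain.cases)
  have v: "v \<in> verts B" using B(3) by blast
  obtain f where f: "labels_with W F {0..12 * n} {1..12 * n} f" "f v = 0"
    using even_chain_labelling[OF B(1)] by blast
  obtain g where g: "labels_with (verts B) (edges B) ({0..<6} \<union> {7}) ({1..<6} \<union> {7}) g"
    "split_at 2 (edges B) g" "g v = 2"
    using one_hexagon_labelling[OF B(2) v] by blast
  have edges: "edges_within (verts B) (edges B)" by (rule edges_within_hexagon[OF B(2)])
  obtain h where h: "labels_with V E
      ({i \<in> {0..<6} \<union> {7}. i \<le> 2} \<union> {2..2 + 12 * n} \<union> (+) (12 * n) ` {i \<in> {0..<6} \<union> {7}. 2 < i})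
      ({1..12 * n} \<union> (+) (12 * n) ` ({1..<6} \<union> {7})) h"
    using glue_labellings[OF g(1,2) edges f(1) edges_within_hexagon_chain[OF B(1)] B(3) f(2) disjI1[OF g(3)]]
    unfolding B(4,5) by blast
  have S: "{1..12 * n} \<union> (+) (12 * n) ` ({1..<6} \<union> {7}) = {1..<12 * n + 6} \<union> {12 * n + 7}"
    by (auto simp: image_Un)
  have L: "{i \<in> {0..<6} \<union> {7}. i \<le> 2} \<union> {2..2 + 12 * n} \<union>
      (+) (12 * n) ` {i \<in> {0..<6} \<union> {7}. 2 < i} \<subseteq> {0..<12 * n + 6} \<union> {12 * n + 7}" by auto
  show ?thesis using labels_with_mono[OF h[unfolded S] L] by blast
qed

section \<open>Connectivity and nonseparable subgraphs\<close>

text \<open>Keeping the edge set apart from the vertex set makes it possible to assemble connectedness of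
  a union, with or without a deleted vertex, from that of its pieces.\<close>

definition linked :: "'a set set \<Rightarrow> 'a set \<Rightarrow> bool" where
  "linked E S \<longleftrightarrow> (\<forall>a\<in>S. \<forall>b\<in>S. (\<lambda>u v. {u, v} \<in> E)\<^sup>*\<^sup>* a b)"

lemma linked_mono: "linked E S \<Longrightarrow> E \<subseteq> F \<Longrightarrow> linked F S"
  unfolding linked_def by (metis (mono_tags, lifting) rtranclp_mono predicate2I predicate2D subsetD)

lemma linked_Un:
  assumes "linked E S" "linked E T" "c \<in> S" "c \<in> T"
  shows "linked E (S \<union> T)"
proof -
  have "(\<lambda>u v. {u, v} \<in> E)\<^sup>*\<^sup>* a c \<and> (\<lambda>u v. {u, v} \<in> E)\<^sup>*\<^sup>* c a" if "a \<in> S \<union> T" for a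
    using assms that unfolding linked_def by (metis Un_iff)
  then show ?thesis unfolding linked_def by (meson rtranclp_trans)
qed

fun walk :: "'a set set \<Rightarrow> 'a list \<Rightarrow> bool" where
  "walk E (x # y # zs) \<longleftrightarrow> {x, y} \<in> E \<and> walk E (y # zs)"
| "walk E _ \<longleftrightarrow> True"

lemma linked_walk: "walk E ps \<Longrightarrow> linked E (set ps)"
proof (induction E ps rule: walk.induct)
  case (1 E x y zs)
  have "linked E {x, y}"
  proof -
    have "{x, y} \<in> E" "{y, x} \<in> E" using "1.prems" by (simp_all add: insert_commute)
    then show ?thesis unfolding linked_def by auto
  qed
  moreover have "linked E (set (y # zs))" using 1 by simp
  ultimately have "linked E ({x, y} \<union> set (y # zs))" by (rule linked_Un[where c = y]) simp_all
  moreover have "{x, y} \<union> set (y # zs) = set (x # y # zs)" by auto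
  ultimately show ?case by simp
qed (simp_all add: linked_def)

lemma walk_append: "walk E (xs @ ys) \<Longrightarrow> walk E xs \<and> walk E ys"
proof (induction xs)
  case (Cons x xs)
  then show ?case by (cases xs; cases ys) auto
qed simp

lemma walk_subset: "walk E ps \<Longrightarrow> (\<And>x y. x \<in> set ps \<Longrightarrow> y \<in> set ps \<Longrightarrow> {x, y} \<in> E \<Longrightarrow> {x, y} \<in> F) \<Longrightarrow> walk F ps"
  by (induction E ps rule: walk.induct) auto

text \<open>Prepending a vertex that already occurs closes a cycle, which is cut off by restarting at
  that occurrence.\<close>

lemma rtranclp_simple_walk:
  assumes "(\<lambda>u v. {u, v} \<in> E)\<^sup>*\<^sup>* u w"
  shows "\<exists>ps. walk E ps \<and> distinct ps \<and> ps \<noteq> [] \<and> hd ps = u \<and> last ps = w"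
  using assms
proof (induction rule: converse_rtranclp_induct)
  case base
  show ?case by (intro exI[of _ "[w]"]) simp
next
  case (step x y)
  then obtain ps where ps: "walk E ps" "distinct ps" "ps \<noteq> []" "hd ps = y" "last ps = w" by blast
  show ?case
  proof (cases "x \<in> set ps")
    case True
    then obtain as bs where "ps = as @ x # bs" by (auto simp: in_set_conv_decomp)
    then show ?thesis using ps walk_append[of E as "x # bs"] by (intro exI[of _ "x # bs"]) auto
  next
    case False
    then show ?thesis using ps step.hyps by (intro exI[of _ "x # ps"]) (cases ps; simp)
  qed
qed

lemma connected_graph_linked: "connected_graph G \<longleftrightarrow> verts G \<noteq> {} \<and> linked (edges G) (verts G)"
  unfolding connected_graph_def linked_def reachable_def by blast

lemma nonseparable_linked:
  "nonseparable G \<longleftrightarrow> verts G \<noteq> {} \<and> linked (edges G) (verts G) \<and>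
     (\<forall>v\<in>verts G. linked {e \<in> edges G. v \<notin> e} (verts G - {v}))"
proof -
  have "cut_vertex G v \<longleftrightarrow> v \<in> verts G \<and> \<not> linked {e \<in> edges G. v \<notin> e} (verts G - {v})"
    if "linked (edges G) (verts G)" for v
    using that unfolding cut_vertex_def linked_def reachable_def delete_vertex_def by auto
  then show ?thesis unfolding nonseparable_def connected_graph_linked by blast
qed

lemma subgraph_refl: "simple_graph G \<Longrightarrow> subgraph G G"
  unfolding subgraph_def by blast

lemma subgraph_trans: "subgraph H K \<Longrightarrow> subgraph K G \<Longrightarrow> subgraph H G"
  unfolding subgraph_def by blast

text \<open>A nonseparable subgraph containing the given one with as many vertices and
  edges as possible is maximal for inclusion.\<close>

lemma nonseparable_in_block:
  assumes G: "simple_graph G" and K: "subgraph K G" "nonseparable K"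
  shows "\<exists>B\<in>blocks G. subgraph K B"
proof -
  define P where "P H \<longleftrightarrow> subgraph H G \<and> nonseparable H \<and> subgraph K H" for H
  define m where "m H = card (verts H) + card (edges H)" for H :: "'a ugraph"
  have fin: "finite (verts G)" "finite (edges G)"
    using G finite_subset[of "edges G" "Pow (verts G)"] by (auto simp: simple_graph_def)
  have "P K" using K subgraph_refl by (auto simp: P_def subgraph_def)
  moreover have "m H \<le> m G" if "P H" for H
    using that fin unfolding P_def m_def subgraph_def by (intro add_mono card_mono) auto
  ultimately obtain B where B: "P B" and max: "\<And>H. P H \<Longrightarrow> m H \<le> m B"
    using ex_has_greatest_nat[of P K m "Suc (m G)"] by (auto simp: less_Suc_eq_le)
  have "H = B" if H: "subgraph H G" "nonseparable H" "subgraph B H" for H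
  proof -
    have "P H" using H B subgraph_trans unfolding P_def by blast
    then have le: "m H \<le> m B" by (rule max)
    have finH: "finite (verts H)" "finite (edges H)" and sub: "verts B \<subseteq> verts H" "edges B \<subseteq> edges H"
      using H fin finite_subset unfolding subgraph_def by blast+
    then have "card (verts B) \<le> card (verts H)" "card (edges B) \<le> card (edges H)"
      by (simp_all add: card_mono)
    then have "card (verts B) = card (verts H)" "card (edges B) = card (edges H)"
      using le unfolding m_def by linarith+
    then have "verts B = verts H" "edges B = edges H"
      using finH sub by (simp_all add: card_subset_eq)
    then show ?thesis by simp
  qed
  then have "B \<in> blocks G" using B unfolding P_def blocks_def by blast
  then show ?thesis using B unfolding P_def by blast
qed

text \<open>Two nonseparable graphs \<open>B\<close> and \<open>C\<close> that meet in \<open>v\<close> are joined by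
  a second route, the path \<open>ps\<close> around \<open>v\<close>. After deleting \<open>v\<close>, the path still links
  \<open>B\<close> and \<open>C\<close>. After deleting another vertex, \<open>v\<close> links them; and the at most two
  parts into which the path falls stay attached, one to \<open>B\<close> at its first vertex and the other
  to \<open>C\<close> at its last. The path may run through \<open>B\<close> and \<open>C\<close> in between.\<close>

lemma nonseparable_join:
  assumes B: "nonseparable B" "v \<in> verts B" "u \<in> verts B" "u \<noteq> v"
    and C: "nonseparable C" "v \<in> verts C" "w \<in> verts C" "w \<noteq> v"
    and ps: "walk F ps" "distinct ps" "ps \<noteq> []" "hd ps = u" "last ps = w" "v \<notin> set ps"
    and sB: "\<And>e. e \<in> edges B \<Longrightarrow> e \<subseteq> verts B" and sC: "\<And>e. e \<in> edges C \<Longrightarrow> e \<subseteq> verts C"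
  shows "nonseparable \<lparr>verts = verts B \<union> verts C \<union> set ps,
           edges = edges B \<union> edges C \<union> {e \<in> F. e \<subseteq> set ps}\<rparr>" (is "nonseparable ?H")
proof -
  let ?E = "edges ?H"
  let ?D = "\<lambda>x. {e \<in> ?E. x \<notin> e}"
  have hd_last: "u \<in> set ps" "w \<in> set ps" using ps(3-5) hd_in_set last_in_set by blast+
  have nonsep: "linked ?E (verts K)" "linked (?D x) (verts K - {x})"
    if "nonseparable K" "edges K \<subseteq> ?E" "\<And>e. e \<in> edges K \<Longrightarrow> e \<subseteq> verts K" for K x
  proof -
    show E: "linked ?E (verts K)"
      using that(1,2) linked_mono[of "edges K" "verts K" ?E] unfolding nonseparable_linked by blast
    show "linked (?D x) (verts K - {x})"
    proof (cases "x \<in> verts K")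
      case True
      then have "linked {e \<in> edges K. x \<notin> e} (verts K - {x})"
        using that(1) unfolding nonseparable_linked by blast
      then show ?thesis using that(2) by (auto elim!: linked_mono)
    next
      case False
      then have "edges K \<subseteq> ?D x" using that(2,3) by blast
      moreover have "linked (edges K) (verts K)"
        using that(1) unfolding nonseparable_linked by blast
      ultimately show ?thesis using False linked_mono[of "edges K" "verts K" "?D x"] by simp
    qed
  qed
  have piece: "linked (?D x) (set qs)" if "walk F qs" "set qs \<subseteq> set ps" "x \<notin> set qs" for qs x
  proof (rule linked_walk, rule walk_subset[OF that(1)])
    fix y z assume "y \<in> set qs" "z \<in> set qs" "{y, z} \<in> F"
    then show "{y, z} \<in> ?D x" using that(2,3) by auto
  qed
  have B1: "linked ?E (verts B)" and B2: "\<And>x. linked (?D x) (verts B - {x})"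
    using nonsep[OF B(1) _ sB] by auto
  have C1: "linked ?E (verts C)" and C2: "\<And>x. linked (?D x) (verts C - {x})"
    using nonsep[OF C(1) _ sC] by auto
  have P1: "linked ?E (set ps)"
    using linked_walk[OF walk_subset[OF ps(1)], of ?E] by auto
  have "linked ?E (verts B \<union> verts C \<union> set ps)"
    using linked_Un[where c = u, OF linked_Un[OF B1 C1 B(2) C(2)] P1] B(3) hd_last by blast
  moreover have "linked (?D x) ((verts B \<union> verts C \<union> set ps) - {x})" for x
  proof (cases "x \<in> set ps")
    case False
    have P2: "linked (?D x) (set ps)" using piece[OF ps(1) subset_refl False] .
    have BP: "linked (?D x) ((verts B - {x}) \<union> set ps)"
      using linked_Un[where c = u, OF B2 P2] B(3) hd_last False by blast
    have "linked (?D x) (((verts B - {x}) \<union> set ps) \<union> (verts C - {x}))"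
    proof (cases "x = v")
      case True
      then show ?thesis using linked_Un[where c = w, OF BP C2] hd_last C(3,4) by blast
    next
      case False
      then show ?thesis using linked_Un[where c = v, OF BP C2] B(2) C(2) by blast
    qed
    moreover have "((verts B - {x}) \<union> set ps) \<union> (verts C - {x}) = (verts B \<union> verts C \<union> set ps) - {x}"
      using False by blast
    ultimately show ?thesis by simp
  next
    case True
    then obtain as bs where ab: "ps = as @ x # bs" by (auto simp: in_set_conv_decomp)
    have xv: "x \<noteq> v" using True ps(6) by blast
    have x: "x \<notin> set as" "x \<notin> set bs" using ps(2) ab by auto
    have "walk F as" "walk F bs"
      using walk_append[of F as "x # bs"] walk_append[of F "as @ [x]" bs] ps(1) ab by auto
    then have as: "linked (?D x) (set as)" and bs: "linked (?D x) (set bs)"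
      using piece x ab by auto
    have "linked (?D x) ((verts B - {x}) \<union> set as)"
    proof (cases as)
      case Nil then show ?thesis using B2 by simp
    next
      case (Cons a as')
      then have "u \<in> set as" using ps(4) ab by simp
      then show ?thesis using linked_Un[where c = u, OF B2 as] B(3) x by blast
    qed
    moreover have "linked (?D x) ((verts C - {x}) \<union> set bs)"
    proof (cases bs rule: rev_cases)
      case Nil then show ?thesis using C2 by simp
    next
      case (snoc bs' b)
      then have "w \<in> set bs" using ps(5) ab by simp
      then show ?thesis using linked_Un[where c = w, OF C2 bs] C(3) x by blast
    qed
    ultimately have "linked (?D x) (((verts B - {x}) \<union> set as) \<union> ((verts C - {x}) \<union> set bs))"
      using linked_Un[where c = v] xv B(2) C(2) by blast
    moreover have "((verts B - {x}) \<union> set as) \<union> ((verts C - {x}) \<union> set bs)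
        = (verts B \<union> verts C \<union> set ps) - {x}" using ab x by auto
    ultimately show ?thesis by simp
  qed
  ultimately show ?thesis using B(2) unfolding nonseparable_linked by auto
qed

text \<open>If \<open>v\<close> were not a cut vertex, a path avoiding it would lead from \<open>B\<close> to
  \<open>C\<close>, and both blocks would lie in the same nonseparable subgraph, contrary to their
  maximality.\<close>

lemma shared_vertex_cut:
  assumes G: "simple_graph G" "connected_graph G"
    and B: "B \<in> blocks G" and C: "C \<in> blocks G" and "B \<noteq> C"
    and v: "v \<in> verts B" "v \<in> verts C"
    and u: "u \<in> verts B" "u \<noteq> v" and w: "w \<in> verts C" "w \<noteq> v"
  shows "cut_vertex G v"
proof (rule ccontr)
  assume no_cut: "\<not> cut_vertex G v"
  let ?F = "{e \<in> edges G. v \<notin> e}"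
  have sB: "subgraph B G" and nB: "nonseparable B" and sC: "subgraph C G" and nC: "nonseparable C"
    using B C by (auto simp: blocks_def)
  have V: "u \<in> verts G" "w \<in> verts G" "v \<in> verts G"
    using sB sC u w v by (auto simp: subgraph_def)
  have "reachable (delete_vertex G v) u w"
    using no_cut V u(2) w(2) G(2) unfolding cut_vertex_def connected_graph_def by blast
  then have "(\<lambda>x y. {x, y} \<in> ?F)\<^sup>*\<^sup>* u w" by (simp add: reachable_def delete_vertex_def)
  from rtranclp_simple_walk[OF this] obtain ps
    where ps: "walk ?F ps" "distinct ps" "ps \<noteq> []" "hd ps = u" "last ps = w" by (elim exE conjE)
  have inside: "set ps \<subseteq> verts G - {v}"
  proof -
    have "walk ?F qs \<Longrightarrow> qs \<noteq> [] \<Longrightarrow> hd qs \<in> verts G - {v} \<Longrightarrow> set qs \<subseteq> verts G - {v}" for qs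
    proof (induction ?F qs rule: walk.induct)
      case (1 x y zs)
      then have "y \<in> verts G" "y \<noteq> v" using G(1) by (auto simp: simple_graph_def)
      then show ?case using 1 by simp
    qed auto
    then show ?thesis using ps V(1) u(2) by blast
  qed
  define H where "H = \<lparr>verts = verts B \<union> verts C \<union> set ps,
    edges = edges B \<union> edges C \<union> {e \<in> ?F. e \<subseteq> set ps}\<rparr>"
  have incident: "\<And>e. e \<in> edges B \<Longrightarrow> e \<subseteq> verts B" "\<And>e. e \<in> edges C \<Longrightarrow> e \<subseteq> verts C"
    using sB sC by (auto simp: subgraph_def simple_graph_def)
  have "nonseparable H"
    unfolding H_def using nonseparable_join[OF nB v(1) u nC v(2) w ps _ incident] inside by blast
  moreover have "subgraph H G" "subgraph B H" "subgraph C H"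
    using sB sC inside G(1) unfolding H_def subgraph_def simple_graph_def by (auto intro: finite_subset)
  ultimately have "H = B" "H = C" using B C by (auto simp: blocks_def)
  then show False using \<open>B \<noteq> C\<close> by simp
qed

section \<open>From the block-cutpoint graph to a chain\<close>

text \<open>Single vertices and single edges are nonseparable, hence contained in blocks.\<close>

lemma blocks_cover:
  assumes G: "simple_graph G"
  shows "\<Union> (verts ` blocks G) = verts G" "\<Union> (edges ` blocks G) = edges G"
proof -
  have sub: "verts B \<subseteq> verts G" "edges B \<subseteq> edges G" if "B \<in> blocks G" for B
    using that by (auto simp: blocks_def subgraph_def)
  have "\<exists>B\<in>blocks G. x \<in> verts B" if x: "x \<in> verts G" for x
  proof -
    let ?K = "\<lparr>verts = {x}, edges = {}\<rparr>"
    have "subgraph ?K G" using x by (simp add: subgraph_def simple_graph_def)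
    moreover have "nonseparable ?K" by (simp add: nonseparable_linked linked_def)
    ultimately obtain B where "B \<in> blocks G" "subgraph ?K B" using nonseparable_in_block[OF G] by blast
    then show ?thesis by (auto simp: subgraph_def)
  qed
  then show "\<Union> (verts ` blocks G) = verts G" using sub(1) by blast
  have "\<exists>B\<in>blocks G. e \<in> edges B" if e: "e \<in> edges G" for e
  proof -
    obtain a b where ab: "e = {a, b}" "a \<noteq> b" "a \<in> verts G" "b \<in> verts G"
      using G e unfolding simple_graph_def by (metis card_2_iff insert_subset)
    let ?K = "\<lparr>verts = {a, b}, edges = {{a, b}}\<rparr>"
    have "subgraph ?K G" using ab e by (simp add: subgraph_def simple_graph_def)
    moreover have "linked {{a, b}} {a, b}"
      using linked_walk[of "{{a, b}}" "[a, b]"] by simp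
    moreover have "linked F ({a, b} - {c})" if "c \<in> {a, b}" for c F
      using that by (auto simp: linked_def)
    ultimately obtain B where "B \<in> blocks G" "subgraph ?K B"
      using nonseparable_in_block[OF G, of ?K] by (auto simp: nonseparable_linked)
    then show ?thesis using ab by (auto simp: subgraph_def)
  qed
  then show "\<Union> (edges ` blocks G) = edges G" using sub(2) by blast
qed

lemma hexagon_other_vertex:
  assumes "cycle_graph 6 B" obtains u where "u \<in> verts B" "u \<noteq> x"
proof -
  obtain a b c d e f where "hexagon B a b c d e f" using cycle_graph_hexagon assms .
  then have "a \<in> verts B" "b \<in> verts B" "a \<noteq> b" by (simp_all add: hexagon_def)
  then show thesis using that by metis
qed

text \<open>Here \<open>xs\<close> is the path of blocks (\<open>Inl\<close>) and cut vertices (\<open>Inr\<close>), and the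
  chain is formed by the blocks from position \<open>i\<close> on. A block meets the union of the later
  ones only in the cut vertex that follows it, and there the chain of the later blocks is
  attached.\<close>

lemma block_path_hexagon_chain:
  assumes dist: "distinct xs"
    and cyc: "\<And>B. Inl B \<in> set xs \<Longrightarrow> cycle_graph 6 B"
    and Inl_next: "\<And>i B. Suc i < length xs \<Longrightarrow> xs ! i = Inl B \<Longrightarrow> \<exists>v. xs ! Suc i = Inr v \<and> v \<in> verts B"
    and Inr_next: "\<And>i v. Suc i < length xs \<Longrightarrow> xs ! i = Inr v \<Longrightarrow> \<exists>B. xs ! Suc i = Inl B \<and> v \<in> verts B"
    and meet: "\<And>i j B C x. i < j \<Longrightarrow> j < length xs \<Longrightarrow> xs ! i = Inl B \<Longrightarrow> xs ! j = Inl C \<Longrightarrow>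
      x \<in> verts B \<Longrightarrow> x \<in> verts C \<Longrightarrow> xs ! Suc i = Inr x"
  shows "i < length xs \<Longrightarrow> xs ! i = Inl B \<Longrightarrow> u \<in> verts B \<Longrightarrow>
    (Suc i < length xs \<Longrightarrow> xs ! Suc i \<noteq> Inr u) \<Longrightarrow>
    hexagon_chain u (card {B. Inl B \<in> set (drop i xs)})
      (\<Union> (verts ` {B. Inl B \<in> set (drop i xs)})) (\<Union> (edges ` {B. Inl B \<in> set (drop i xs)}))"
proof (induction "length xs - i" arbitrary: i B u rule: less_induct)
  case less
  let ?Bs = "\<lambda>i. {B. Inl B \<in> set (drop i xs)}"
  have "Inl B \<in> set xs" using less.prems(1,2) by (metis nth_mem)
  then have B: "cycle_graph 6 B" by (rule cyc)
  have drop: "drop i xs = Inl B # drop (Suc i) xs"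
    using less.prems(1,2) by (metis Cons_nth_drop_Suc)
  show ?case
  proof (cases "Suc (Suc i) < length xs")
    case True
    obtain v where v: "xs ! Suc i = Inr v" "v \<in> verts B"
      using Inl_next[OF _ less.prems(2)] True by auto
    obtain C where C: "xs ! Suc (Suc i) = Inl C" "v \<in> verts C"
      using Inr_next[OF True v(1)] by auto
    let ?V = "\<Union> (verts ` ?Bs (Suc (Suc i)))"
    have "drop (Suc i) xs = Inr v # drop (Suc (Suc i)) xs"
      using True v(1) by (metis Cons_nth_drop_Suc Suc_lessD)
    then have Bs: "?Bs i = insert B (?Bs (Suc (Suc i)))" using drop by auto
    have "distinct (drop i xs)" using dist by simp
    then have B_new: "B \<notin> ?Bs (Suc (Suc i))"
      using drop \<open>drop (Suc i) xs = Inr v # drop (Suc (Suc i)) xs\<close> by auto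
    have fin: "finite (?Bs (Suc (Suc i)))"
      using finite_vimageI[of "set (drop (Suc (Suc i)) xs)" Inl] by (simp add: vimage_def)
    \<comment> \<open>Distinctness of the path makes the exit of the next block differ from its entry.\<close>
    have "xs ! Suc (Suc (Suc i)) \<noteq> Inr v" if "Suc (Suc (Suc i)) < length xs"
      using dist that v(1) nth_eq_iff_index_eq[of xs "Suc (Suc (Suc i))" "Suc i"] by auto
    then have tail: "hexagon_chain v (card (?Bs (Suc (Suc i)))) ?V (\<Union> (edges ` ?Bs (Suc (Suc i))))"
      using less.hyps[of "Suc (Suc i)" C v] True C by auto
    have "x = v" if x: "x \<in> verts B" "x \<in> ?V" for x
    proof -
      obtain D where D: "Inl D \<in> set (drop (Suc (Suc i)) xs)" "x \<in> verts D" using x(2) by blast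
      then obtain j where "j < length xs - Suc (Suc i)" "xs ! (Suc (Suc i) + j) = Inl D"
        by (auto simp: in_set_conv_nth)
      then show ?thesis
        using meet[of i "Suc (Suc i) + j" B D x] less.prems(2) x(1) D(2) v(1) by simp
    qed
    moreover have "v \<in> ?V"
    proof -
      have "Inl C \<in> set (drop (Suc (Suc i)) xs)"
        using True C(1) by (metis Cons_nth_drop_Suc list.set_intros(1))
      then show ?thesis using C(2) by blast
    qed
    ultimately have inter: "verts B \<inter> ?V = {v}" using v(2) by blast
    have "u \<noteq> v" using less.prems(4) True v(1) by auto
    from attach[OF tail B less.prems(3) this inter] show ?thesis
      unfolding Bs using fin B_new by simp
  next
    case False
    have "set (drop (Suc i) xs) \<subseteq> range Inr"
    proof (cases "Suc i < length xs")
      case True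
      then obtain v where "xs ! Suc i = Inr v" using Inl_next[OF _ less.prems(2)] by auto
      moreover have "drop (Suc i) xs = [xs ! Suc i]"
        using True False by (metis Cons_nth_drop_Suc drop_all not_less)
      ultimately show ?thesis by simp
    qed simp
    then have "?Bs i = {B}" unfolding drop by auto
    \<comment> \<open>The last block is attached to a chain without hexagons at an arbitrary second vertex.\<close>
    moreover obtain v where v: "v \<in> verts B" "v \<noteq> u" using hexagon_other_vertex[OF B] by blast
    have "verts B \<inter> {v} = {v}" using v by blast
    then have "hexagon_chain u (Suc 0) (verts B \<union> {v}) (edges B \<union> {})"
      using attach[OF empty B less.prems(3) v(2)[symmetric]] by blast
    moreover have "verts B \<union> {v} = verts B" using v by blast
    ultimately show ?thesis by simp
  qed
qed

text \<open>A vertex of two blocks is a cut vertex, hence occurs in the path, adjacent to both blocks;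
  this places it between them and makes them consecutive.\<close>

lemma cyclic_snake_hexagon_chain:
  assumes "k \<ge> 1" and G: "cyclic_snake k 6 G"
  shows "\<exists>u. hexagon_chain u k (verts G) (edges G)"
proof -
  have simple: "simple_graph G" and conn: "connected_graph G" and k: "card (blocks G) = k"
    and hex: "\<And>B. B \<in> blocks G \<Longrightarrow> cycle_graph 6 B"
    using G by (auto simp: cyclic_snake_def)
  obtain xs where xs: "xs \<noteq> []" "distinct xs" "verts (block_cutpoint_graph G) = set xs"
    "edges (block_cutpoint_graph G) = {{xs ! i, xs ! Suc i} | i. Suc i < length xs}"
    using G unfolding cyclic_snake_def path_graph_def by blast
  have set_xs: "Inl B \<in> set xs \<longleftrightarrow> B \<in> blocks G" "Inr v \<in> set xs \<longleftrightarrow> cut_vertex G v" for B v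
    unfolding xs(3)[symmetric] by (auto simp: block_cutpoint_graph_def)
  have incident: "\<exists>B v. {xs ! i, xs ! Suc i} = {Inl B, Inr v} \<and> v \<in> verts B" if "Suc i < length xs" for i
  proof -
    have "{xs ! i, xs ! Suc i} \<in> edges (block_cutpoint_graph G)" using that xs(4) by blast
    then show ?thesis by (auto simp: block_cutpoint_graph_def)
  qed
  have adjacent: "q = Suc p \<or> p = Suc q"
    if pq: "p < length xs" "q < length xs" "xs ! p = Inl B" "xs ! q = Inr v" "v \<in> verts B" for p q B v
  proof -
    have "{Inl B, Inr v} \<in> edges (block_cutpoint_graph G)"
      using pq set_xs nth_mem[OF pq(1)] nth_mem[OF pq(2)] by (auto simp: block_cutpoint_graph_def)
    then obtain i where "Suc i < length xs" "{xs ! p, xs ! q} = {xs ! i, xs ! Suc i}"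
      using xs(4) pq(3,4) by auto
    then show ?thesis using pq(1,2) xs(2) by (auto simp: doubleton_eq_iff nth_eq_iff_index_eq)
  qed
  have meet: "xs ! Suc i = Inr x"
    if ij: "i < j" "j < length xs" "xs ! i = Inl B" "xs ! j = Inl C" "x \<in> verts B" "x \<in> verts C"
    for i j B C x
  proof -
    have B: "B \<in> blocks G" and C: "C \<in> blocks G"
      using ij set_xs nth_mem[of i xs] nth_mem[of j xs] by auto
    have "B \<noteq> C" using ij xs(2) nth_eq_iff_index_eq[of xs i j] by auto
    moreover obtain u where "u \<in> verts B" "u \<noteq> x" using hexagon_other_vertex[OF hex[OF B]] .
    moreover obtain w where "w \<in> verts C" "w \<noteq> x" using hexagon_other_vertex[OF hex[OF C]] .
    ultimately have "cut_vertex G x" using shared_vertex_cut[OF simple conn B C] ij(5,6) by blast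
    then obtain q where q: "q < length xs" "xs ! q = Inr x"
      using set_xs(2) by (metis in_set_conv_nth)
    have "q = Suc i \<or> i = Suc q" "q = Suc j \<or> j = Suc q"
      using adjacent[OF _ q(1) _ q(2)] ij by auto
    then show ?thesis using q(2) ij(1) by auto
  qed
  have Inl_next: "\<exists>v. xs ! Suc i = Inr v \<and> v \<in> verts B" if "Suc i < length xs" "xs ! i = Inl B" for i B
    using incident[OF that(1)] that(2) by (auto simp: doubleton_eq_iff)
  have Inr_next: "\<exists>B. xs ! Suc i = Inl B \<and> v \<in> verts B" if "Suc i < length xs" "xs ! i = Inr v" for i v
    using incident[OF that(1)] that(2) by (auto simp: doubleton_eq_iff)
  \<comment> \<open>The first block is at position 0, or at position 1 should the path start with a cut
    vertex.\<close>
  obtain i where i: "i < length xs" "isl (xs ! i)" "blocks G = {B. Inl B \<in> set (drop i xs)}"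
  proof (cases "xs ! 0")
    case (Inl B)
    then show thesis using that[of 0] xs(1) set_xs(1) by simp
  next
    case (Inr v)
    then have "xs = Inr v # drop 1 xs" using xs(1) by (cases xs) auto
    then have eq: "blocks G = {B. Inl B \<in> set (drop 1 xs)}"
      using set_xs(1) by (metis (no_types, lifting) Collect_cong Collect_mem_eq Inl_Inr_False set_ConsD list.set_intros(2))
    have "blocks G \<noteq> {}" using k \<open>k \<ge> 1\<close> by auto
    then have "1 < length xs" using eq by (cases "1 < length xs") auto
    moreover have "isl (xs ! 1)" using Inr_next[of 0] Inr calculation by auto
    ultimately show thesis using that[of 1] eq by blast
  qed
  then obtain B where B: "xs ! i = Inl B" by (auto simp: isl_def)
  then have "B \<in> blocks G" using i(1) set_xs(1) by (metis nth_mem)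
  then have "cycle_graph 6 B" by (rule hex)
  \<comment> \<open>Past the end of the list \<open>xs ! Suc i\<close> is some unspecified value, which is avoided
    all the same.\<close>
  then obtain u where u: "u \<in> verts B" "Inr u \<noteq> xs ! Suc i"
    using hexagon_other_vertex[of B "projr (xs ! Suc i)"] by (metis sum.sel(2))
  have "hexagon_chain u (card {B. Inl B \<in> set (drop i xs)})
      (\<Union> (verts ` {B. Inl B \<in> set (drop i xs)})) (\<Union> (edges ` {B. Inl B \<in> set (drop i xs)}))"
  proof (rule block_path_hexagon_chain[OF xs(2)])
    show "cycle_graph 6 B'" if "Inl B' \<in> set xs" for B' using that set_xs(1) hex by simp
  qed (use Inl_next Inr_next meet i(1) B u in simp_all)
  then show ?thesis unfolding i(3)[symmetric] blocks_cover[OF simple] k by blast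
qed

theorem theorem3p1:
  fixes G :: "'a ugraph" and k :: nat
  assumes "k \<ge> 1" and "cyclic_snake k 6 G"
  shows "(even k \<longrightarrow> graceful G) \<and>
         (odd k \<longrightarrow> (\<exists>f. near_graceful_labelling G f \<and>
            f ` verts G \<subseteq> {0..<card (edges G)} \<union> {card (edges G) + 1} \<and>
            bij_betw (edge_label f) (edges G) ({1..<card (edges G)} \<union> {card (edges G) + 1})))"
proof -
  obtain u where chain: "hexagon_chain u k (verts G) (edges G)"
    using cyclic_snake_hexagon_chain[OF assms] by blast
  show ?thesis
  proof (intro conjI impI)
    assume "even k"
    then obtain n where n: "k = 2 * n" by (elim evenE)
    obtain f where f: "labels_with (verts G) (edges G) {0..12 * n} {1..12 * n} f"
      using even_chain_labelling[OF chain[unfolded n]] by blast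
    then have "card (edges G) = 12 * n"
      unfolding labels_with_def using bij_betw_same_card by fastforce
    then show "graceful G"
      using f unfolding graceful_def graceful_labelling_def labels_with_def by auto
  next
    assume "odd k"
    then obtain n where n: "k = Suc (2 * n)" by (elim oddE) simp
    obtain f where f: "labels_with (verts G) (edges G)
        ({0..<12 * n + 6} \<union> {12 * n + 7}) ({1..<12 * n + 6} \<union> {12 * n + 7}) f"
      using odd_chain_labelling[OF chain[unfolded n]] by blast
    have "card ({1..<12 * n + 6} \<union> {12 * n + 7}) = 12 * n + 6" by simp
    then have m: "card (edges G) = 12 * n + 6"
      using f unfolding labels_with_def using bij_betw_same_card by metis
    then have m1: "card (edges G) + 1 = 12 * n + 7" by simp
    have "f ` verts G \<subseteq> {0..<card (edges G)} \<union> {card (edges G) + 1}"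
      and "bij_betw (edge_label f) (edges G) ({1..<card (edges G)} \<union> {card (edges G) + 1})"
      and "inj_on f (verts G)"
      using f unfolding labels_with_def m1 unfolding m by simp_all
    moreover have "{0..<card (edges G)} \<union> {card (edges G) + 1} \<subseteq> {0..card (edges G) + 1}" by auto
    ultimately show "\<exists>f. near_graceful_labelling G f \<and>
        f ` verts G \<subseteq> {0..<card (edges G)} \<union> {card (edges G) + 1} \<and>
        bij_betw (edge_label f) (edges G) ({1..<card (edges G)} \<union> {card (edges G) + 1})"
      unfolding near_graceful_labelling_def by blast
  qed
qed

end
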